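(* Let $C_5=\langle g\rangle$ be the cyclic group of order $5$. Then the following hold. (i) $\mathcal{U}(\mathbb{F}_2C_5)=\langle 1+g+g^2\rangle\ (\simeq C_{15})$. (ii) For $r>1$, $$\mathcal{U}(\mathbb{Z}_{2^r}C_5)=G_1\times G_2\times G_3\times G_4\times G_5\times G_6\times G_7$$ (internal direct product), where $G_1=\langle 5\rangle\ (\simeq C_{2^{r-2}})$, $G_2=\langle -1\rangle\ (\simeq C_2)$, $G_3=\langle 1+g+g^2\rangle\ (\simeq C_{15\cdot 2^{r-1}})$, $G_4=\langle 1+2g\rangle\ (\simeq C_{2^{r-1}})$, $G_5=\langle 1+2g^2\rangle\ (\simeq C_{2^{r-1}})$, $G_6=\langle 1+4g\rangle\ (\simeq C_{2^{r-2}})$, and $G_7=\langle (1-a)\hat g-1\rangle\ (\simeq C_2)$ with $a=3\cdot 5^{-1}\bmod 2^r$.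
   Context: $\mathcal{U}(R)$ denotes the group of units of a ring $R$, $\mathbb{Z}_{2^r}$ the ring of integers modulo $2^r$, $C_n$ the cyclic group of order $n$, and $\langle\cdot\rangle$ the multiplicative subgroup generated by an element. Here $\hat g=1+g+g^2+g^3+g^4$, and $5^{-1}$ is the inverse of $5$ in $\mathbb{Z}_{2^r}$. *)

theory Defs
  imports "HOL-Algebra.Algebra" "HOL-Number_Theory.Residues"
begin

(* The product is convolution: the coefficient of f * h at x is the sum of
   f(y) h(y^-1 x) over the (finite) support of f.  Elements are extensional
   functions, so that equality of elements is equality of coefficients. *)
definition group_ring ::
  "('r, 'm) ring_scheme \<Rightarrow> ('g, 'n) monoid_scheme \<Rightarrow> ('g \<Rightarrow> 'r) ring"
  where "group_ring R G =
    \<lparr>carrier = {f \<in> carrier G \<rightarrow>\<^sub>E carrier R. finite {x \<in> carrier G. f x \<noteq> \<zero>\<^bsub>R\<^esub>}},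
     monoid.mult = (\<lambda>f h. \<lambda>x \<in> carrier G.
       (\<Oplus>\<^bsub>R\<^esub>y \<in> {y \<in> carrier G. f y \<noteq> \<zero>\<^bsub>R\<^esub>}. f y \<otimes>\<^bsub>R\<^esub> h (inv\<^bsub>G\<^esub> y \<otimes>\<^bsub>G\<^esub> x))),
     one = (\<lambda>x \<in> carrier G. if x = \<one>\<^bsub>G\<^esub> then \<one>\<^bsub>R\<^esub> else \<zero>\<^bsub>R\<^esub>),
     ring.zero = (\<lambda>x \<in> carrier G. \<zero>\<^bsub>R\<^esub>),
     ring.add = (\<lambda>f h. \<lambda>x \<in> carrier G. f x \<oplus>\<^bsub>R\<^esub> h x)\<rparr>"

(* The element c x of RG; x = 1 embeds the scalars, c = 1 the group. *)
definition gr_monom ::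
  "('r, 'm) ring_scheme \<Rightarrow> ('g, 'n) monoid_scheme \<Rightarrow> 'r \<Rightarrow> 'g \<Rightarrow> 'g \<Rightarrow> 'r"
  where "gr_monom R G c x = (\<lambda>y \<in> carrier G. if y = x then c else \<zero>\<^bsub>R\<^esub>)"

definition internal_direct_product ::
  "('a, 'm) monoid_scheme \<Rightarrow> 'i set \<Rightarrow> ('i \<Rightarrow> 'a set) \<Rightarrow> bool"
  where "internal_direct_product G I H \<longleftrightarrow>
    (\<forall>i\<in>I. H i \<lhd> G) \<and>
    generate G (\<Union>i\<in>I. H i) = carrier G \<and>
    (\<forall>i\<in>I. H i \<inter> generate G (\<Union>j\<in>I - {i}. H j) = {\<one>\<^bsub>G\<^esub>})"

end

theory Submission
  imports Defs
begin

text \<open>The group ring of the cyclic group of order 5 over the integers modulo \<open>m\<close> is the quotient of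
  the integral group ring by \<open>m\<close>, so all computations take place in the latter.  For \<open>m = 2\<close>, an
  element with augmentation 1 other than the sum of all group elements is one of the 15 powers of
  \<open>1 + g + g\<^sup>2\<close>, and no other element is a unit.  For \<open>m = 2 ^ r\<close>, the units congruent to 1 are
  filtered by the subgroups \<open>1 + 2 ^ k A\<close>; multiplication induces addition modulo 2 on the layers
  \<open>1 + 2 ^ k v\<close>, and repeated squaring carries \<open>1 + 2 ^ k v\<close> to \<open>1 + 2 ^ (k + 1) v\<close> for
  \<open>k \<ge> 2\<close>.  Hence suitable powers of the seven generators span every layer as soon as they span
  the first two, so they generate the unit group.  The order \<open>15 * 2 ^ (5 * (r - 1))\<close> of the unit
  group equals the product of the bounds on the orders of the generators, which forces the
  decomposition to be direct.\<close>

section \<open>Cyclic decompositions of finite abelian groups\<close>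

lemma (in group) generate_singleton_card_le:
  assumes a: "a \<in> carrier G" and n: "0 < n" "a [^] (n::nat) = \<one>"
  shows "finite (generate G {a})" and "card (generate G {a}) \<le> n"
proof -
  have "finite (carrier (subgroup_generated G {a}))"
    using finite_cyclic_subgroup[OF a] n by auto
  then show fin: "finite (generate G {a})"
    using a by (simp add: carrier_subgroup_generated)
  have "ord a dvd n"
    using pow_eq_id[OF a] n by simp
  then show "card (generate G {a}) \<le> n"
    using n generate_pow_card[OF a] dvd_imp_le by metis
qed

text \<open>The map sending \<open>i\<close> to \<open>a [^] i\<close> identifies exactly the
  exponents that agree modulo \<open>ord a\<close>. With \<open>0 < n\<close> the residues from 0 to
  \<open>n - 1\<close> represent the classes, as in \<open>integer_mod_group n\<close>.\<close>

lemma (in group) generate_singleton_iso: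
  assumes a: "a \<in> carrier G" and n: "0 < n" and card: "card (generate G {a}) = n"
  shows "G\<lparr>carrier := generate G {a}\<rparr> \<cong> integer_mod_group n"
proof -
  have ord: "ord a = n"
    using card generate_pow_card[OF a] by simp
  define h where "h = (\<lambda>i::int. a [^] i)"
  have eq: "h i = h j \<longleftrightarrow> i mod n = j mod n" for i j :: int
    unfolding h_def using int_pow_eq[OF a] ord by (metis mod_eq_dvd_iff)
  have "h \<in> iso (integer_mod_group n) (G\<lparr>carrier := generate G {a}\<rparr>)"
  proof (rule isoI)
    have "h (i mod n) \<in> generate G {a}" for i :: int
      using a unfolding generate_pow[OF a] h_def by blast
    moreover have "h ((i + j) mod n) = h i \<otimes> h j" for i j :: int
    proof -
      have "h ((i + j) mod n) = h (i + j)"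
        by (simp add: eq)
      then show ?thesis
        using a by (simp add: h_def int_pow_mult)
    qed
    ultimately show "h \<in> hom (integer_mod_group n) (G\<lparr>carrier := generate G {a}\<rparr>)"
      using a by (auto simp: hom_def generate_pow h_def)
    show "bij_betw h (carrier (integer_mod_group n)) (carrier (G\<lparr>carrier := generate G {a}\<rparr>))"
      unfolding bij_betw_def
    proof
      show "inj_on h (carrier (integer_mod_group n))"
        using n by (auto simp: inj_on_def eq carrier_integer_mod_group)
      have "\<exists>j\<in>{0..<int n}. h i = h j" for i :: int
        using n eq[of i "i mod n"] by (intro bexI[of _ "i mod n"]) auto
      then show "h ` carrier (integer_mod_group n) = carrier (G\<lparr>carrier := generate G {a}\<rparr>)"
        using a n by (auto simp: carrier_integer_mod_group generate_pow h_def image_iff)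
    qed
  qed
  then show ?thesis
    by (meson group.iso_sym group_integer_mod_group is_isoI)
qed

text \<open>Commutativity makes the product set of two subgroups a subgroup, so it suffices that it
  contains both generating sets.\<close>

lemma (in comm_group) generate_Un_subset_set_mult:
  assumes "A \<subseteq> carrier G" "B \<subseteq> carrier G"
  shows "generate G (A \<union> B) \<subseteq> generate G A <#> generate G B"
proof (rule generate_subgroup_incl)
  have sub: "subgroup (generate G A) G" "subgroup (generate G B) G"
    using assms generate_is_subgroup by auto
  show "subgroup (generate G A <#> generate G B) G"
    using sub by (rule mult_subgroups)
  have "a \<otimes> \<one> \<in> generate G A <#> generate G B" if "a \<in> A" for a
    unfolding set_mult_def using that by (blast intro: generate.incl generate.one)
  moreover have "\<one> \<otimes> b \<in> generate G A <#> generate G B" if "b \<in> B" for b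
    unfolding set_mult_def using that by (blast intro: generate.incl generate.one)
  ultimately show "A \<union> B \<subseteq> generate G A <#> generate G B"
    using assms by (auto simp: subset_iff)
qed

lemma (in group) card_set_mult_le:
  assumes "finite H" "finite K"
  shows "finite (H <#> K)" and "card (H <#> K) \<le> card H * card K"
proof -
  have eq: "H <#> K = (\<lambda>(h, k). h \<otimes> k) ` (H \<times> K)"
    by (auto simp: set_mult_def)
  show "finite (H <#> K)"
    unfolding eq using assms by simp
  show "card (H <#> K) \<le> card H * card K"
    unfolding eq using assms card_image_le[of "H \<times> K" "\<lambda>(h, k). h \<otimes> k"]
    by (simp add: card_cartesian_product)
qed

text \<open>Induction on \<open>I\<close>: a further generator leads at most to a product set with a
  cyclic group of at most \<open>n i\<close> elements. No independence of the generators is assumed,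
  hence only a bound.\<close>

lemma (in comm_group) generate_card_le_prod:
  assumes "finite I" and "\<And>i. i \<in> I \<Longrightarrow> a i \<in> carrier G"
    and "\<And>i. i \<in> I \<Longrightarrow> 0 < n i" and "\<And>i. i \<in> I \<Longrightarrow> a i [^] (n i :: nat) = \<one>"
  shows "finite (generate G (a ` I)) \<and> card (generate G (a ` I)) \<le> (\<Prod>i\<in>I. n i)"
  using assms
proof (induction I rule: finite_induct)
  case empty
  then show ?case by (simp add: generate_empty)
next
  case (insert i I)
  let ?H = "generate G {a i}" and ?K = "generate G (a ` I)"
  have sub: "generate G (a ` insert i I) \<subseteq> ?H <#> ?K"
    using generate_Un_subset_set_mult[of "{a i}" "a ` I"] insert.prems(1) by auto
  have H: "finite ?H" "card ?H \<le> n i"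
    using generate_singleton_card_le[of "a i" "n i"] insert.prems by auto
  have K: "finite ?K" "card ?K \<le> (\<Prod>i\<in>I. n i)"
    using insert by auto
  have "card (generate G (a ` insert i I)) \<le> card (?H <#> ?K)"
    using sub card_set_mult_le(1)[OF H(1) K(1)] card_mono by blast
  also have "\<dots> \<le> n i * (\<Prod>i\<in>I. n i)"
    using card_set_mult_le(2)[OF H(1) K(1)] H(2) K(2) mult_le_mono le_trans by blast
  finally show ?case
    using insert.hyps sub card_set_mult_le(1)[OF H(1) K(1)] finite_subset by auto
qed

text \<open>Agreement is demanded on the index set only, because lookups in a mapped list simplify
  only for indices below its length.\<close>

lemma internal_direct_product_cong:
  assumes "\<And>i. i \<in> I \<Longrightarrow> H i = K i"
  shows "internal_direct_product G I H \<longleftrightarrow> internal_direct_product G I K"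
proof -
  have "(\<Union>i\<in>J. H i) = (\<Union>i\<in>J. K i)" if "J \<subseteq> I" for J
    using assms that by auto
  from this[of I] this[of "I - {i}" for i] show ?thesis
    using assms by (simp add: internal_direct_product_def)
qed

text \<open>By counting: the multiplication map from \<open>H i\<close> times the subgroup generated by the other
  factors is onto \<open>G\<close>, and its domain has at most as many elements as \<open>G\<close>, so it is injective.\<close>

theorem (in comm_group) cyclic_decomposition:
  assumes I: "finite I" and a: "\<And>i. i \<in> I \<Longrightarrow> a i \<in> carrier G"
    and n: "\<And>i. i \<in> I \<Longrightarrow> 0 < n i" and pow: "\<And>i. i \<in> I \<Longrightarrow> a i [^] (n i :: nat) = \<one>"
    and gen: "carrier G \<subseteq> generate G (a ` I)" and card: "(\<Prod>i\<in>I. n i) \<le> order G"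
  shows "internal_direct_product G I (\<lambda>i. generate G {a i})"
    and "\<And>i. i \<in> I \<Longrightarrow> G\<lparr>carrier := generate G {a i}\<rparr> \<cong> integer_mod_group (n i)"
proof -
  define H where "H = (\<lambda>i. generate G {a i})"
  define K where "K = (\<lambda>i. generate G (a ` (I - {i})))"
  have aI: "a ` I \<subseteq> carrier G"
    using a by auto
  have H_sub: "subgroup (H i) G" if "i \<in> I" for i
    unfolding H_def using that a by (intro generate_is_subgroup) auto
  have gen_UN: "generate G (\<Union>j\<in>J. H j) = generate G (a ` J)" if J: "J \<subseteq> I" for J
  proof
    have sub: "subgroup (generate G (a ` J)) G"
      using J a by (intro generate_is_subgroup) auto
    have "H j \<subseteq> generate G (a ` J)" if "j \<in> J" for j
      unfolding H_def using that by (intro mono_generate) auto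
    then show "generate G (\<Union>j\<in>J. H j) \<subseteq> generate G (a ` J)"
      using sub by (intro generate_subgroup_incl) auto
    show "generate G (a ` J) \<subseteq> generate G (\<Union>j\<in>J. H j)"
      by (intro mono_generate) (auto simp: H_def intro: generate.incl)
  qed
  have main: "card (H i) = n i \<and> H i \<inter> K i = {\<one>}" if i: "i \<in> I" for i
  proof -
    have H: "finite (H i)" "card (H i) \<le> n i"
      unfolding H_def using generate_singleton_card_le[of "a i" "n i"] a n pow i by auto
    have K: "finite (K i)" "card (K i) \<le> (\<Prod>j\<in>I - {i}. n j)"
      unfolding K_def using generate_card_le_prod[of "I - {i}" a n] I a n pow by auto
    have K_sub: "subgroup (K i) G"
      unfolding K_def using a by (intro generate_is_subgroup) auto
    define f where "f = (\<lambda>(h, k). h \<otimes> k)"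
    have "a ` I = {a i} \<union> a ` (I - {i})"
      using i by auto
    then have "carrier G \<subseteq> H i <#> K i"
      using gen generate_Un_subset_set_mult[of "{a i}" "a ` (I - {i})"] a i
      unfolding H_def K_def by auto
    then have "carrier G \<subseteq> f ` (H i \<times> K i)"
      by (auto simp: f_def set_mult_def)
    then have "order G \<le> card (f ` (H i \<times> K i))"
      unfolding order_def using H(1) K(1) by (intro card_mono) auto
    moreover have "card (f ` (H i \<times> K i)) \<le> card (H i \<times> K i)"
      using H(1) K(1) by (intro card_image_le) auto
    moreover have prod: "(\<Prod>i\<in>I. n i) = n i * (\<Prod>j\<in>I - {i}. n j)"
      using I i by (simp add: prod.remove)
    moreover have le: "card (H i) * card (K i) \<le> n i * (\<Prod>j\<in>I - {i}. n j)"
      using H(2) K(2) by (rule mult_le_mono)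
    \<comment> \<open>The order of \<open>G\<close> is at most the size of the image, which is at
      most \<open>card (H i) * card (K i)\<close>, which is at most the product of all
      \<open>n i\<close>, which is at most the order again; so all are equal.\<close>
    ultimately have eq: "card (f ` (H i \<times> K i)) = card (H i \<times> K i)"
      and eq2: "card (H i) * card (K i) = n i * (\<Prod>j\<in>I - {i}. n j)"
      using card by (simp_all add: card_cartesian_product)
    have "inj_on f (H i \<times> K i)"
      using eq H(1) K(1) by (intro eq_card_imp_inj_on) auto
    have "x = \<one>" if x: "x \<in> H i" "x \<in> K i" for x
    proof -
      have xG: "x \<in> carrier G"
        using x H_sub[OF i] subgroup.mem_carrier by metis
      \<comment> \<open>A common element \<open>x\<close> has the two preimages
        \<open>(x, \<one>)\<close> and \<open>(\<one>, x)\<close> under \<open>f\<close>.\<close>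
      have "(x, \<one>) \<in> H i \<times> K i" "(\<one>, x) \<in> H i \<times> K i"
        using x H_sub[OF i] K_sub subgroup.one_closed by auto
      moreover have "f (x, \<one>) = f (\<one>, x)"
        using xG by (simp add: f_def)
      ultimately show ?thesis
        using \<open>inj_on f (H i \<times> K i)\<close> by (auto dest: inj_onD)
    qed
    then have "H i \<inter> K i = {\<one>}"
      using H_sub[OF i] K_sub subgroup.one_closed by auto
    moreover have "card (H i) = n i"
    \<comment> \<open>A smaller \<open>H i\<close> could not be compensated by \<open>K i\<close>,
      whose size is bounded by the positive product of the other \<open>n j\<close>.\<close>
    proof (rule ccontr)
      assume "card (H i) \<noteq> n i"
      then have lt: "card (H i) < n i"
        using H(2) by simp
      have "0 < (\<Prod>j\<in>I - {i}. n j)"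
        using n by (intro prod_pos) auto
      then have "card (H i) * (\<Prod>j\<in>I - {i}. n j) < n i * (\<Prod>j\<in>I - {i}. n j)"
        using lt by simp
      moreover have "card (H i) * card (K i) \<le> card (H i) * (\<Prod>j\<in>I - {i}. n j)"
        using K(2) by simp
      ultimately show False
        using eq2 by simp
    qed
    ultimately show ?thesis
      by simp
  qed
  have "H i \<lhd> G" if "i \<in> I" for i
    using H_sub[OF that] subgroup_imp_normal by blast
  moreover have "generate G (\<Union>i\<in>I. H i) = carrier G"
    using gen gen_UN[of I] generate_incl[OF aI] by auto
  moreover have "H i \<inter> generate G (\<Union>j\<in>I - {i}. H j) = {\<one>}" if "i \<in> I" for i
    using main[OF that] gen_UN[of "I - {i}"] by (auto simp: K_def)
  ultimately show "internal_direct_product G I (\<lambda>i. generate G {a i})"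
    unfolding internal_direct_product_def H_def by blast
  show "G\<lparr>carrier := generate G {a i}\<rparr> \<cong> integer_mod_group (n i)" if "i \<in> I" for i
    using main[OF that] that a n generate_singleton_iso by (auto simp: H_def)
qed

section \<open>The integral group ring of the cyclic group of order 5\<close>

text \<open>The arguments of the constructor are the coefficients of the powers of the generator, in
  increasing order.\<close>

datatype zc5 = ZC int int int int int

instantiation zc5 :: comm_ring_1
begin

definition "0 = ZC 0 0 0 0 0"

definition "1 = ZC 1 0 0 0 0"

fun plus_zc5 where
  "ZC a b c d e + ZC a' b' c' d' e' = ZC (a + a') (b + b') (c + c') (d + d') (e + e')"

fun minus_zc5 where
  "ZC a b c d e - ZC a' b' c' d' e' = ZC (a - a') (b - b') (c - c') (d - d') (e - e')"

fun uminus_zc5 where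
  "- ZC a b c d e = ZC (- a) (- b) (- c) (- d) (- e)"

text \<open>Cyclic convolution: each row collects the products whose exponents have the same sum
  modulo 5.\<close>

fun times_zc5 where
  "ZC a b c d e * ZC a' b' c' d' e' =
    ZC (a * a' + b * e' + c * d' + d * c' + e * b')
       (a * b' + b * a' + c * e' + d * d' + e * c')
       (a * c' + b * b' + c * a' + d * e' + e * d')
       (a * d' + b * c' + c * b' + d * a' + e * e')
       (a * e' + b * d' + c * c' + d * b' + e * a')"

instance
proof
  fix a b c :: zc5
  show "a + b + c = a + (b + c)"
    by (cases a; cases b; cases c) (simp add: zero_zc5_def one_zc5_def algebra_simps)
  show "a + b = b + a"
    by (cases a; cases b) (simp add: zero_zc5_def one_zc5_def algebra_simps)
  show "0 + a = a"
    by (cases a) (simp add: zero_zc5_def one_zc5_def algebra_simps)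
  show "- a + a = 0"
    by (cases a) (simp add: zero_zc5_def one_zc5_def algebra_simps)
  show "a - b = a + - b"
    by (cases a; cases b) (simp add: zero_zc5_def one_zc5_def algebra_simps)
  show "a * b * c = a * (b * c)"
    by (cases a; cases b; cases c) (simp add: zero_zc5_def one_zc5_def algebra_simps)
  show "a * b = b * a"
    by (cases a; cases b) (simp add: zero_zc5_def one_zc5_def algebra_simps)
  show "1 * a = a"
    by (cases a) (simp add: zero_zc5_def one_zc5_def algebra_simps)
  show "(a + b) * c = a * c + b * c"
    by (cases a; cases b; cases c) (simp add: zero_zc5_def one_zc5_def algebra_simps)
  show "0 \<noteq> (1::zc5)"
    by (simp add: zero_zc5_def one_zc5_def)
qed

end

fun zcoeff :: "zc5 \<Rightarrow> nat \<Rightarrow> int" where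
  "zcoeff (ZC a b c d e) i = [a, b, c, d, e] ! i"

fun aug :: "zc5 \<Rightarrow> int" where
  "aug (ZC a b c d e) = a + b + c + d + e"

text \<open>The augmentation is the ring homomorphism sending the group generator to 1; an even
  value rules out a unit modulo 2.\<close>

lemma aug_mult: "aug (u * v) = aug u * aug v"
  by (cases u; cases v) (simp add: algebra_simps)

lemma of_nat_zc5: "of_nat n = ZC (int n) 0 0 0 0"
  by (induction n) (simp_all add: zero_zc5_def one_zc5_def)

lemma of_int_zc5: "of_int z = ZC z 0 0 0 0"
  by (cases z rule: int_diff_cases) (simp add: of_nat_zc5)

lemma numeral_zc5: "numeral n = ZC (numeral n) 0 0 0 0"
  using of_int_zc5[of "numeral n"] by simp

lemma of_int_dvd_zc5_iff:
  "of_int m dvd ZC a b c d e \<longleftrightarrow> m dvd a \<and> m dvd b \<and> m dvd c \<and> m dvd d \<and> m dvd e"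
proof
  assume "of_int m dvd ZC a b c d e"
  then obtain w where w: "ZC a b c d e = of_int m * w" ..
  then show "m dvd a \<and> m dvd b \<and> m dvd c \<and> m dvd d \<and> m dvd e"
    by (cases w) (simp add: of_int_zc5)
next
  assume "m dvd a \<and> m dvd b \<and> m dvd c \<and> m dvd d \<and> m dvd e"
  then have "ZC a b c d e = of_int m * ZC (a div m) (b div m) (c div m) (d div m) (e div m)"
    by (simp add: of_int_zc5)
  then show "of_int m dvd ZC a b c d e" ..
qed

lemma numeral_power_dvd_zc5_iff:
  "numeral n ^ k dvd ZC a b c d e \<longleftrightarrow>
    numeral n ^ k dvd a \<and> numeral n ^ k dvd b \<and> numeral n ^ k dvd c \<and> numeral n ^ k dvd d \<and> numeral n ^ k dvd e"
  using of_int_dvd_zc5_iff[of "numeral n ^ k"] by simp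

lemma numeral_dvd_zc5_iff:
  "numeral n dvd ZC a b c d e \<longleftrightarrow>
    numeral n dvd a \<and> numeral n dvd b \<and> numeral n dvd c \<and> numeral n dvd d \<and> numeral n dvd e"
  using numeral_power_dvd_zc5_iff[of n 1] by simp

text \<open>The second form catches divisors that \<open>numeral_zc5\<close> has already turned into
  constructor terms.\<close>

lemmas zc5_dvd_iff = numeral_dvd_zc5_iff of_int_dvd_zc5_iff [unfolded of_int_zc5]

section \<open>Distinguished elements and their reduction modulo 2\<close>

abbreviation zgen :: zc5 where "zgen \<equiv> ZC 0 1 0 0 0"

abbreviation ztri :: zc5 where "ztri \<equiv> ZC 1 1 1 0 0"

abbreviation zhat :: zc5 where "zhat \<equiv> ZC 1 1 1 1 1"

fun zodd :: "zc5 \<Rightarrow> bool list" where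
  "zodd (ZC a b c d e) = [odd a, odd b, odd c, odd d, odd e]"

lemma zodd_eq_iff: "zodd u = zodd v \<longleftrightarrow> 2 dvd u - v"
  by (cases u; cases v) (auto simp: numeral_dvd_zc5_iff)

text \<open>The table is integral rather than modulo 2, since the layer computations need more of
  the fifteenth power than its parities.\<close>

lemma ztri_powers:
  "map (\<lambda>j. ztri ^ j) [0..<16] = [ZC 1 0 0 0 0, ZC 1 1 1 0 0, ZC 1 2 3 2 1, ZC 4 4 6 7 6,
    ZC 17 14 14 17 19, ZC 53 50 45 45 50, ZC 148 153 148 140 140, ZC 428 441 449 441 428,
    ZC 1297 1297 1318 1331 1318, ZC 3946 3912 3912 3946 3967, ZC 11859 11825 11770 11770 11825,
    ZC 35454 35509 35454 35365 35365, ZC 106184 106328 106417 106328 106184,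
    ZC 318696 318696 318929 319073 318929, ZC 956698 956321 956321 956698 956931,
    ZC 2870327 2869950 2869340 2869340 2869950]"
  by (simp add: upt_rec one_zc5_def numeral_eq_Suc)

text \<open>These are all lists of length 5 with an odd number of \<open>True\<close> entries,
  except the one without \<open>False\<close>.\<close>

lemma zodd_ztri_powers:
  "map (\<lambda>j. zodd (ztri ^ j)) [0..<15] = [
    [True, False, False, False, False], [True, True, True, False, False],
    [True, False, True, False, True], [False, False, False, True, False],
    [True, False, False, True, True], [True, False, True, True, False],
    [False, True, False, False, False], [False, True, True, True, False],
    [True, True, False, True, False], [False, False, False, False, True],
    [True, True, False, False, True], [False, True, False, True, True],
    [False, False, True, False, False], [False, False, True, True, True],
    [False, True, True, False, True]]"
proof -
  have "map (\<lambda>j. zodd (ztri ^ j)) [0..<15] = map zodd (take 15 (map (\<lambda>j. ztri ^ j) [0..<16]))"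
    by (simp add: take_map comp_def del: upt_Suc)
  then show ?thesis
    unfolding ztri_powers by simp
qed

lemma ztri_power_15: "ztri ^ 15 = ZC 2870327 2869950 2869340 2869340 2869950"
  using arg_cong[OF ztri_powers, of "\<lambda>xs. xs ! 15"] by (simp del: upt_Suc)

section \<open>Principal units modulo powers of two\<close>

text \<open>Squaring \<open>1 + 2 ^ k * x\<close> gives
  \<open>1 + 2 ^ Suc k * x + 2 ^ (2 * k) * x\<^sup>2\<close>, and \<open>2 * k\<close> is at least
  \<open>k + 2\<close> exactly when \<open>k\<close> is at least 2.\<close>

lemma square_step:
  fixes u v :: "'a::comm_ring_1"
  assumes "2 \<le> k" and "2 ^ Suc k dvd u - (1 + 2 ^ k * v)"
  shows "2 ^ Suc (Suc k) dvd u\<^sup>2 - (1 + 2 ^ Suc k * v)"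
proof -
  obtain l where l: "k = 2 + l"
    using assms(1) le_Suc_ex by blast
  obtain w where w: "u - (1 + 2 ^ k * v) = 2 ^ Suc k * w"
    using assms(2) ..
  define q :: 'a where "q = 2 ^ l"
  have q: "2 ^ k = 4 * q"
    by (simp add: l q_def power_add)
  have u: "u = 1 + 4 * q * (v + 2 * w)"
    using w by (simp add: q diff_eq_eq) (simp add: algebra_simps)
  have "u\<^sup>2 - (1 + 2 ^ Suc k * v) = 2 ^ Suc (Suc k) * (w + q * (v + 2 * w)\<^sup>2)"
    unfolding u power_Suc q by (simp add: power2_eq_square algebra_simps)
  then show ?thesis ..
qed

text \<open>Squaring \<open>k - 2\<close> times moves an element known modulo 8 from level 2 to
  level \<open>k\<close>.\<close>

lemma power_two_step:
  fixes u v :: "'a::comm_ring_1"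
  assumes "8 dvd u - (1 + 4 * v)" "2 \<le> k"
  shows "2 ^ Suc k dvd u ^ (2 ^ (k - 2)) - (1 + 2 ^ k * v)"
  using assms(2)
proof (induction k rule: dec_induct)
  case base
  then show ?case using assms(1) by simp
next
  case (step k)
  have "Suc k - 2 = Suc (k - 2)"
    using step.hyps(1) by (rule Suc_diff_le)
  then have "u ^ (2 ^ (Suc k - 2)) = (u ^ (2 ^ (k - 2)))\<^sup>2"
    by (simp only: power_Suc2 power_mult)
  then show ?case
    using square_step[OF step.hyps(1) step.IH] by simp
qed

lemma power_two_dvd:
  fixes u v :: "'a::comm_ring_1"
  assumes "4 dvd u - 1" "2 \<le> k"
  shows "2 ^ k dvd u ^ (2 ^ (k - 2)) - 1"
proof -
  obtain v where "u - 1 = 4 * v"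
    using assms(1) ..
  then have "8 dvd u - (1 + 4 * v)"
    by (simp add: algebra_simps)
  from power_two_step[OF this assms(2)] have "2 ^ k dvd u ^ (2 ^ (k - 2)) - (1 + 2 ^ k * v)"
    by (metis dvd_trans le_imp_power_dvd lessI less_imp_le)
  then have "2 ^ k dvd u ^ (2 ^ (k - 2)) - (1 + 2 ^ k * v) + 2 ^ k * v"
    by (rule dvd_add) simp
  then show ?thesis
    by simp
qed

text \<open>An element congruent to 1 only modulo 2 needs one extra squaring:
  \<open>(1 + 2 * v)\<^sup>2 = 1 + 4 * (v + v\<^sup>2)\<close> puts it in the scope of
  \<open>power_two_dvd\<close>.\<close>

lemma power_two_dvd':
  fixes u :: "'a::comm_ring_1"
  assumes "2 dvd u - 1"
  shows "2 ^ Suc k dvd u ^ (2 ^ k) - 1"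
proof (cases k)
  case 0
  then show ?thesis using assms by simp
next
  case (Suc l)
  obtain v where "u - 1 = 2 * v"
    using assms ..
  then have "u = 1 + 2 * v"
    by (simp add: algebra_simps)
  then have "u\<^sup>2 - 1 = 4 * (v + v\<^sup>2)"
    by (simp add: power2_eq_square algebra_simps)
  then have "4 dvd u\<^sup>2 - 1" ..
  then show ?thesis
    using power_two_dvd[of "u\<^sup>2" "Suc k"] Suc by (simp add: power_mult [symmetric])
qed

section \<open>Congruences as divisibility of differences\<close>

lemma dvd_diff_sym:
  fixes u v :: "'a::comm_ring_1"
  assumes "d dvd u - v"
  shows "d dvd v - u"
  using assms dvd_minus_iff[of d "u - v"] by simp

lemma dvd_diff_trans:
  fixes u v w :: "'a::comm_ring_1"
  assumes "d dvd u - v" "d dvd v - w"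
  shows "d dvd u - w"
  using dvd_add[OF assms] by simp

lemma dvd_diff_mult:
  fixes u v u' v' :: "'a::comm_ring_1"
  assumes "d dvd u - u'" "d dvd v - v'"
  shows "d dvd u * v - u' * v'"
proof -
  have "u * v - u' * v' = (u - u') * v + u' * (v - v')"
    by (simp add: algebra_simps)
  then show ?thesis
    using assms by simp
qed

lemma dvd_diff_power:
  fixes u v :: "'a::comm_ring_1"
  assumes "d dvd u - v"
  shows "d dvd u ^ n - v ^ n"
  by (induction n) (use assms dvd_diff_mult in auto)

text \<open>Such a \<open>P\<close> is the full preimage of a subgroup of the units modulo
  \<open>2 ^ r\<close>. Working with preimages keeps all computations in \<open>'a\<close>.\<close>

locale subgroup_mod_two_power =
  fixes P :: "'a::comm_ring_1 set" and r :: nat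
  assumes one: "1 \<in> P"
    and mult: "\<lbrakk>u \<in> P; v \<in> P\<rbrakk> \<Longrightarrow> u * v \<in> P"
    and inverse: "u \<in> P \<Longrightarrow> \<exists>v\<in>P. 2 ^ r dvd u * v - 1"
    and cong: "\<lbrakk>u \<in> P; 2 ^ r dvd v - u\<rbrakk> \<Longrightarrow> v \<in> P"
begin

text \<open>For positive \<open>k\<close> this is the trace of \<open>P\<close> on the quotient of
  \<open>1 + 2 ^ k A\<close> by \<open>1 + 2 ^ (k + 1) A\<close>, which is a copy of
  \<open>A\<close> modulo 2; it is pulled back to \<open>A\<close>.\<close>

definition layer :: "nat \<Rightarrow> 'a set" where
  "layer k = {v. \<exists>h\<in>P. 2 ^ Suc k dvd h - (1 + 2 ^ k * v)}"

lemma power: "u \<in> P \<Longrightarrow> u ^ n \<in> P"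
  by (induction n) (simp_all add: one mult)

lemma layer_cong:
  assumes v: "v \<in> layer k" and "2 dvd v - w"
  shows "w \<in> layer k"
proof -
  obtain h where h: "h \<in> P" "2 ^ Suc k dvd h - (1 + 2 ^ k * v)"
    using v by (auto simp: layer_def)
  have "2 ^ k * 2 dvd 2 ^ k * (v - w)"
    using assms(2) by (intro mult_dvd_mono) auto
  then have "2 ^ Suc k dvd (1 + 2 ^ k * v) - (1 + 2 ^ k * w)"
    by (simp add: algebra_simps)
  then show ?thesis
    using h dvd_diff_trans unfolding layer_def by blast
qed

text \<open>The cross term of the product carries the factor \<open>2 ^ (2 * k)\<close>, which
  vanishes modulo \<open>2 ^ Suc k\<close> because \<open>k\<close> is positive.\<close>

lemma layer_add:
  assumes "1 \<le> k" and v: "v \<in> layer k" and w: "w \<in> layer k"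
  shows "v + w \<in> layer k"
proof -
  obtain l where k: "k = Suc l"
    using assms(1) by (metis Suc_le_D One_nat_def)
  obtain h where h: "h \<in> P" "2 ^ Suc k dvd h - (1 + 2 ^ k * v)"
    using v by (auto simp: layer_def)
  obtain h' where h': "h' \<in> P" "2 ^ Suc k dvd h' - (1 + 2 ^ k * w)"
    using w by (auto simp: layer_def)
  have "(1 + 2 ^ k * v) * (1 + 2 ^ k * w) - (1 + 2 ^ k * (v + w)) = 2 ^ Suc k * (2 ^ l * v * w)"
    unfolding k by (simp add: algebra_simps)
  then have "2 ^ Suc k dvd (1 + 2 ^ k * v) * (1 + 2 ^ k * w) - (1 + 2 ^ k * (v + w))" ..
  then have "2 ^ Suc k dvd h * h' - (1 + 2 ^ k * (v + w))"
    using dvd_diff_mult[OF h(2) h'(2)] dvd_diff_trans by blast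
  then show ?thesis
    using mult[OF h(1) h'(1)] by (auto simp: layer_def)
qed

lemma layer_of_int_mult:
  assumes v: "v \<in> layer k"
  shows "of_int z * v \<in> layer k"
proof (cases "even z")
  case True
  have "0 \<in> layer k"
    using one by (auto simp: layer_def intro!: bexI[of _ 1])
  moreover have "2 dvd 0 - of_int z * v"
    using True by (auto elim!: evenE simp: mult.assoc)
  ultimately show ?thesis
    by (rule layer_cong)
next
  case False
  then obtain y where "z = 2 * y + 1"
    by (elim oddE)
  then have "v - of_int z * v = 2 * (- of_int y * v)"
    by (simp add: algebra_simps)
  then have "2 dvd v - of_int z * v" ..
  with v show ?thesis
    by (rule layer_cong)
qed

text \<open>Dividing \<open>u\<close> by \<open>h\<close> gives an element congruent to 1 modulo
  \<open>2 ^ k\<close>, to which \<open>principal\<close> applies.\<close>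

lemma mem_if_principal_units_mem:
  assumes h: "h \<in> P" "2 ^ k dvd u - h" and "k \<le> r"
    and principal: "\<And>w. 2 ^ k dvd w - 1 \<Longrightarrow> w \<in> P"
  shows "u \<in> P"
proof -
  obtain h' where h': "h' \<in> P" "2 ^ r dvd h * h' - 1"
    using inverse[OF h(1)] by blast
  have "2 ^ k dvd h * h' - 1"
    using h'(2) \<open>k \<le> r\<close> by (metis dvd_trans le_imp_power_dvd)
  moreover have "2 ^ k dvd u * h' - h * h'"
    using h(2) by (intro dvd_diff_mult) simp_all
  ultimately have "u * h' \<in> P"
    using principal dvd_diff_trans by blast
  then have "u * h' * h \<in> P"
    using h(1) by (rule mult)
  \<comment> \<open>Multiplying back by \<open>h\<close> recovers \<open>u\<close> only modulo
    \<open>2 ^ r\<close>, which \<open>cong\<close> absorbs.\<close>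
  moreover have "2 ^ r dvd 1 - h * h'"
    using h'(2) by (rule dvd_diff_sym)
  then have "2 ^ r dvd u * 1 - u * (h * h')"
    by (intro dvd_diff_mult) simp_all
  ultimately show ?thesis
    using cong[of "u * h' * h" u] by (simp add: mult_ac)
qed

text \<open>Induction on \<open>r - k\<close>: a full layer \<open>k\<close> provides an element of
  \<open>P\<close> that agrees with \<open>u\<close> modulo \<open>2 ^ Suc k\<close>, and their
  quotient is covered one level higher. From \<open>k = r\<close> on, \<open>u\<close> is congruent
  to 1 modulo \<open>2 ^ r\<close>.\<close>

lemma principal_units_mem:
  assumes layers: "\<And>j. \<lbrakk>k \<le> j; j < r\<rbrakk> \<Longrightarrow> layer j = UNIV" and "2 ^ k dvd u - 1"
  shows "u \<in> P"
  using assms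
proof (induction "r - k" arbitrary: k u)
  case 0
  then have "2 ^ r dvd u - 1"
    by (metis diff_is_0_eq dvd_trans le_imp_power_dvd)
  then show ?case
    using one cong by blast
next
  case (Suc n)
  obtain v where "u - 1 = 2 ^ k * v"
    using Suc.prems(2) ..
  then have u: "u = 1 + 2 ^ k * v"
    by (simp add: algebra_simps)
  have "v \<in> layer k"
    using Suc by simp
  then obtain h where h: "h \<in> P" "2 ^ Suc k dvd h - u"
    by (auto simp: layer_def u)
  have "w \<in> P" if "2 ^ Suc k dvd w - 1" for w
    using Suc that by (intro Suc.hyps(1)[of "Suc k"]) auto
  then show ?case
    using h Suc.hyps(2)
    by (intro mem_if_principal_units_mem[OF h(1) dvd_diff_sym[OF h(2)]]) auto
qed

lemma mem_layer:
  assumes "u \<in> P" "8 dvd u - (1 + 4 * v)" "2 \<le> k"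
  shows "v \<in> layer k"
  using power_two_step[OF assms(2,3)] power[OF assms(1)] by (auto simp: layer_def)

end

text \<open>Odd augmentation leaves sixteen parity patterns. Once the all-odd one is excluded, the
  other fifteen are the tabulated powers.\<close>

lemma unit_mod_two_zc5:
  fixes u v :: zc5
  assumes "2 dvd u * v - 1"
  shows "\<exists>j<15. 2 dvd u - ztri ^ j"
proof -
  obtain a b c d e where u: "u = ZC a b c d e"
    by (cases u)
  obtain a' b' c' d' e' where v: "v = ZC a' b' c' d' e'"
    by (cases v)
  have dvd: "odd (a * a' + b * e' + c * d' + d * c' + e * b')"
       "even (a * b' + b * a' + c * e' + d * d' + e * c')"
       "even (a * c' + b * b' + c * a' + d * e' + e * d')"
       "even (a * d' + b * c' + c * b' + d * a' + e * e')"
       "even (a * e' + b * d' + c * c' + d * b' + e * a')"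
    using assms by (simp_all add: u v one_zc5_def zc5_dvd_iff)
  have "zodd u \<in> set (map (\<lambda>j. zodd (ztri ^ j)) [0..<15])"
  proof -
    have "odd (a + b + c + d + e)"
    proof -
      have "odd (aug (u * v))"
        using dvd by (simp add: u v)
      then show ?thesis
        by (simp only: aug_mult) (simp add: u v)
    qed
    moreover have "even a \<or> even b \<or> even c \<or> even d \<or> even e"
    \<comment> \<open>If all coefficients of \<open>u\<close> were odd, every coefficient of
      \<open>u * v\<close> would have the parity of \<open>aug v\<close>, but the first two have
      different parities.\<close>
    proof (rule ccontr)
      assume "\<not> ?thesis"
      then show False
        using dvd(1,2)
        by (cases "even a'"; cases "even b'"; cases "even c'"; cases "even d'"; cases "even e'") simp_all
    qed
    ultimately show ?thesis
      unfolding zodd_ztri_powers u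
      by (cases "even a"; cases "even b"; cases "even c"; cases "even d"; cases "even e") simp_all
  qed
  then show ?thesis
    by (auto simp: zodd_eq_iff)
qed

lemma distinct_ztri_powers_mod_two:
  assumes "2 dvd ztri ^ i - ztri ^ j" "i < 15" "j < 15"
  shows "i = j"
proof -
  have "distinct (map (\<lambda>j. zodd (ztri ^ j)) [0..<15])"
    unfolding zodd_ztri_powers by simp
  then show ?thesis
    using assms by (auto simp: distinct_map inj_on_def zodd_eq_iff)
qed

section \<open>Generation of the units by the seven elements\<close>

locale subgroup_mod_two_power_zc5 = subgroup_mod_two_power P r for P :: "zc5 set" and r

text \<open>The five vectors form a basis modulo 2. The unusual last one is the shape in which the
  generators deliver the missing direction.\<close>

lemma (in subgroup_mod_two_power_zc5) layer_eq_UNIV: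
  assumes "1 \<le> k"
    and 0: "ZC 1 0 0 0 0 \<in> layer k" and 1: "ZC 0 1 0 0 0 \<in> layer k"
    and 2: "ZC 0 0 1 0 0 \<in> layer k" and 4: "ZC 0 0 0 0 1 \<in> layer k"
    and hat: "ZC 0 1 1 1 1 \<in> layer k"
  shows "layer k = UNIV"
proof -
  have "ZC 0 1 1 1 1 + (ZC 0 1 0 0 0 + (ZC 0 0 1 0 0 + ZC 0 0 0 0 1)) \<in> layer k"
    using assms by (intro layer_add)
  then have 3: "ZC 0 0 0 1 0 \<in> layer k"
    by (rule layer_cong) (simp add: zc5_dvd_iff)
  have "ZC a b c d e \<in> layer k" for a b c d e
  proof -
    have "of_int a * ZC 1 0 0 0 0 + (of_int b * ZC 0 1 0 0 0 + (of_int c * ZC 0 0 1 0 0 +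
        (of_int d * ZC 0 0 0 1 0 + of_int e * ZC 0 0 0 0 1))) \<in> layer k"
      using assms 3 by (intro layer_add layer_of_int_mult)
    then show ?thesis
      by (simp add: of_int_zc5)
  qed
  then have "u \<in> layer k" for u
    by (cases u) simp
  then show ?thesis
    by auto
qed

text \<open>The parameter \<open>c\<close> is the coefficient \<open>1 - a\<close> of the last generator; as \<open>5 * a = 3\<close>, it is
  determined by \<open>5 * c = 2\<close>.\<close>

definition zc5_generators :: "int \<Rightarrow> zc5 list" where
  "zc5_generators c = [5, -1, ztri, 1 + 2 * zgen, 1 + 2 * zgen\<^sup>2, 1 + 4 * zgen, of_int c * zhat - 1]"

lemma length_zc5_generators: "length (zc5_generators c) = 7"
  by (simp add: zc5_generators_def)

text \<open>All layers from 1 on are shown to be full, so \<open>P\<close> contains everything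
  congruent to 1 modulo 2; powers of \<open>ztri\<close> reach the remaining classes. Layer 1 is
  separate because \<open>square_step\<close> starts at level 2.\<close>

theorem (in subgroup_mod_two_power_zc5) unit_mem:
  assumes "2 \<le> r" and gens: "set (zc5_generators c) \<subseteq> P"
    and c: "[5 * c = 2] (mod 2 ^ r)" and uv: "2 dvd u * v - 1"
  shows "u \<in> P"
proof -
  have g: "5 \<in> P" "-1 \<in> P" "ztri \<in> P" "1 + 2 * zgen \<in> P" "1 + 2 * zgen\<^sup>2 \<in> P" "1 + 4 * zgen \<in> P"
    "of_int c * zhat - 1 \<in> P"
    using gens by (auto simp: zc5_generators_def)
  have "layer k = UNIV" if "2 \<le> k" for k
  proof (rule layer_eq_UNIV)
    show k: "1 \<le> k" using that by simp
    note mem = mem_layer[OF _ _ that]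
    show 0: "ZC 1 0 0 0 0 \<in> layer k"
      using g(1) by (rule mem) (simp add: numeral_zc5 one_zc5_def zc5_dvd_iff)
    show 1: "ZC 0 1 0 0 0 \<in> layer k"
      using g(6) by (rule mem) (simp add: numeral_zc5 one_zc5_def zc5_dvd_iff)
    \<comment> \<open>The square of \<open>1 + 2 * zgen\<close> is
      \<open>1 + 4 * (zgen + zgen\<^sup>2)\<close>.\<close>
    have "ZC 0 1 1 0 0 \<in> layer k"
      using power[OF g(4), of 2]
      by (rule mem) (simp add: numeral_zc5 one_zc5_def zc5_dvd_iff power2_eq_square)
    then have "ZC 0 1 1 0 0 + ZC 0 1 0 0 0 \<in> layer k"
      using k 1 by (intro layer_add)
    then show 2: "ZC 0 0 1 0 0 \<in> layer k"
      by (rule layer_cong) (simp add: zc5_dvd_iff)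
    have "ZC 0 0 1 0 1 \<in> layer k"
      using power[OF g(5), of 2]
      by (rule mem) (simp add: numeral_zc5 one_zc5_def zc5_dvd_iff power2_eq_square)
    then have "ZC 0 0 1 0 1 + ZC 0 0 1 0 0 \<in> layer k"
      using k 2 by (intro layer_add)
    then show "ZC 0 0 0 0 1 \<in> layer k"
      by (rule layer_cong) (simp add: zc5_dvd_iff)
    define w where "w = ZC 1435163 1434975 1434670 1434670 1434975" \<comment> \<open>\<open>ztri ^ 15 = 1 + 2 * w\<close>\<close>
    have "(ztri ^ 15)\<^sup>2 - (1 + 4 * (w + w\<^sup>2)) = 0"
      by (simp add: ztri_power_15 w_def numeral_zc5 one_zc5_def zero_zc5_def power2_eq_square)
    then have "8 dvd (ztri ^ 15)\<^sup>2 - (1 + 4 * (w + w\<^sup>2))"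
      by (simp only: dvd_0_right)
    then have "w + w\<^sup>2 \<in> layer k"
      by (rule mem[OF power[OF power[OF g(3)]]])
    \<comment> \<open>Modulo 2, \<open>w\<close> is \<open>ZC 1 1 0 0 1\<close> and squaring doubles
      the exponents, so \<open>w\<^sup>2\<close> is \<open>ZC 1 0 1 1 0\<close>.\<close>
    then show "ZC 0 1 1 1 1 \<in> layer k"
      by (rule layer_cong) (simp add: w_def power2_eq_square zc5_dvd_iff)
  qed
  moreover have "layer 1 = UNIV"
  proof (rule layer_eq_UNIV)
    have mem: "v \<in> layer 1" if "h \<in> P" "4 dvd h - (1 + 2 * v)" for h v
      using that by (auto simp: layer_def)
    \<comment> \<open>Modulo 4, \<open>-1\<close> is \<open>1 + 2\<close>.\<close>
    show 0: "ZC 1 0 0 0 0 \<in> layer 1"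
      using g(2) by (rule mem) (simp add: numeral_zc5 one_zc5_def zc5_dvd_iff)
    show 1: "ZC 0 1 0 0 0 \<in> layer 1"
      using g(4) by (rule mem) (simp add: numeral_zc5 one_zc5_def zc5_dvd_iff)
    show "ZC 0 0 1 0 0 \<in> layer 1"
      using g(5) by (rule mem) (simp add: numeral_zc5 one_zc5_def zc5_dvd_iff power2_eq_square)
    have "ZC 1 1 0 0 1 \<in> layer 1"
      using power[OF g(3), of 15]
      by (rule mem) (simp add: ztri_power_15 numeral_zc5 one_zc5_def zc5_dvd_iff)
    then have "ZC 1 1 0 0 1 + (ZC 1 0 0 0 0 + ZC 0 1 0 0 0) \<in> layer 1"
      using 0 1 by (intro layer_add) simp_all
    then show "ZC 0 0 0 0 1 \<in> layer 1"
      by (rule layer_cong) (simp add: zc5_dvd_iff)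
    \<comment> \<open>From \<open>5 * c = 2\<close> modulo 4 follows \<open>c = 2\<close> modulo 4,
      so the last generator is \<open>2 * zhat - 1\<close> there.\<close>
    have "(4::int) dvd 2 ^ r"
      using le_imp_power_dvd[OF \<open>2 \<le> r\<close>, of "2::int"] by simp
    then have "[5 * c = 2] (mod 4)"
      using c cong_dvd_modulus by blast
    then have "4 dvd c - 2"
      unfolding cong_iff_dvd_diff by presburger
    then have "4 dvd ZC (c - 2) (c - 2) (c - 2) (c - 2) (c - 2)"
      unfolding numeral_dvd_zc5_iff by blast
    moreover have "of_int c * zhat - 1 - (1 + 2 * ZC 0 1 1 1 1) = ZC (c - 2) (c - 2) (c - 2) (c - 2) (c - 2)"
      by (simp add: numeral_zc5 of_int_zc5 one_zc5_def)
    ultimately have "4 dvd of_int c * zhat - 1 - (1 + 2 * ZC 0 1 1 1 1)"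
      by (simp only:)
    then show "ZC 0 1 1 1 1 \<in> layer 1"
      by (rule mem[OF g(7)])
  qed simp_all
  ultimately have "layer k = UNIV" if "1 \<le> k" for k
    using that by (metis Suc_1 Suc_leI le_neq_implies_less One_nat_def)
  then have principal: "w \<in> P" if "2 ^ 1 dvd w - 1" for w
    using principal_units_mem[of 1 w] that by simp
  obtain j where j: "2 ^ 1 dvd u - ztri ^ j"
    using unit_mod_two_zc5[OF uv] by auto
  show ?thesis
    using \<open>2 \<le> r\<close> by (intro mem_if_principal_units_mem[OF power[OF g(3)] j _ principal]) auto
qed

text \<open>The exponents are only upper bounds for the orders here; counting later makes them
  exact. They depend on whether a generator, or \<open>ztri ^ 15\<close>, is congruent to 1 modulo 4
  or just modulo 2; \<open>-1\<close> and the last generator are involutions.\<close>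

lemma zc5_generators_power:
  assumes "2 \<le> r" and c: "[5 * c = 2] (mod 2 ^ r)" and "i < 7"
  shows "2 ^ r dvd (zc5_generators c ! i) ^
    ([2 ^ (r - 2), 2, 15 * 2 ^ (r - 1), 2 ^ (r - 1), 2 ^ (r - 1), 2 ^ (r - 2), 2] ! i) - 1"
proof -
  have r: "Suc (r - 1) = r"
    using assms by simp
  note even = power_two_dvd'[of _ "r - 1", unfolded r]
  have 0: "2 ^ r dvd (5::zc5) ^ (2 ^ (r - 2)) - 1"
    using assms(1) by (intro power_two_dvd) simp_all
  have 2: "2 ^ r dvd ztri ^ (15 * 2 ^ (r - 1)) - 1"
    unfolding power_mult
    by (intro even) (simp add: ztri_power_15 one_zc5_def zc5_dvd_iff)
  have 3: "2 ^ r dvd (1 + 2 * x) ^ (2 ^ (r - 1)) - 1" for x :: zc5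
    by (intro even) simp
  have 4: "2 ^ r dvd (1 + 4 * x) ^ (2 ^ (r - 2)) - 1" for x :: zc5
    using assms(1) by (intro power_two_dvd) simp_all
  \<comment> \<open>This rests on \<open>zhat\<^sup>2 = 5 * zhat\<close>.\<close>
  have "(of_int c * zhat - 1)\<^sup>2 - 1 = of_int (5 * c - 2) * of_int c * zhat"
    by (simp add: of_int_zc5 one_zc5_def numeral_zc5 power2_eq_square algebra_simps)
  moreover have "of_int (2 ^ r) dvd (of_int (5 * c - 2) :: zc5)"
    using c of_int_dvd_zc5_iff[of "2 ^ r" "5 * c - 2" 0 0 0 0] by (simp only: of_int_zc5 cong_iff_dvd_diff) simp
  ultimately have 6: "2 ^ r dvd (of_int c * zhat - 1)\<^sup>2 - 1"
    by simp
  have "i \<in> {0, 1, 2, 3, 4, 5, 6}"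
    using assms(3) by auto
  then show ?thesis
    using 0 2 3 4 6 by (auto simp: zc5_generators_def)
qed

section \<open>The group ring as a quotient\<close>

text \<open>Ring laws pass to homomorphic images, so none has to be checked on the convolution
  product of \<open>group_ring\<close>.\<close>

locale comm_ring_image =
  fixes A :: "('a, 'm) ring_scheme" (structure) and \<phi> :: "'c::comm_ring_1 \<Rightarrow> 'a"
  assumes carrier_eq: "carrier A = range \<phi>"
    and hom_zero: "\<phi> 0 = \<zero>" and hom_one: "\<phi> 1 = \<one>"
    and hom_add: "\<phi> (u + v) = \<phi> u \<oplus> \<phi> v"
    and hom_mult: "\<phi> (u * v) = \<phi> u \<otimes> \<phi> v"

sublocale comm_ring_image \<subseteq> cring A
proof (rule cringI)
  have closed: "\<phi> u \<in> carrier A" for u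
    by (simp add: carrier_eq)
  show "abelian_group A"
  proof (rule abelian_groupI)
    fix x assume "x \<in> carrier A"
    then obtain u where "x = \<phi> u"
      unfolding carrier_eq by blast
    then have "\<phi> (- u) \<oplus> x = \<zero>"
      by (simp flip: hom_add hom_zero)
    then show "\<exists>y\<in>carrier A. y \<oplus> x = \<zero>"
      using closed by blast
  qed (auto simp: carrier_eq ac_simps simp flip: hom_add hom_zero)
  show "comm_monoid A"
    by (rule comm_monoidI) (auto simp: carrier_eq ac_simps simp flip: hom_mult hom_one)
qed (auto simp: carrier_eq distrib_right simp flip: hom_mult hom_add)

context comm_ring_image
begin

lemma hom_closed [simp]: "\<phi> u \<in> carrier A"
  by (simp add: carrier_eq)

lemma hom_uminus: "\<phi> (- u) = \<ominus> \<phi> u"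
proof -
  have "\<phi> (- u) \<oplus> \<phi> u = \<zero>"
    by (simp flip: hom_add hom_zero)
  then show ?thesis
    using minus_equality hom_closed by metis
qed

lemma hom_diff: "\<phi> (u - v) = \<phi> u \<ominus> \<phi> v"
  unfolding a_minus_def hom_uminus [symmetric] hom_add [symmetric] by simp

lemma hom_power: "\<phi> (u ^ n) = \<phi> u [^] (n::nat)"
  by (induction n) (simp_all add: hom_one hom_mult m_comm)

lemma hom_of_nat_mult: "\<phi> (of_nat n * u) = [(n::nat)] \<cdot> \<phi> u"
  by (induction n) (simp_all add: hom_zero hom_add distrib_right a_comm)

lemma hom_numeral_mult: "\<phi> (numeral n * u) = [(numeral n :: nat)] \<cdot> \<phi> u"
  using hom_of_nat_mult[of "numeral n" u] by simp

lemma Units_iff: "\<phi> u \<in> Units A \<longleftrightarrow> (\<exists>v. \<phi> (u * v) = \<phi> 1)"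
proof
  assume u: "\<phi> u \<in> Units A"
  then obtain v where "inv \<phi> u = \<phi> v"
    using Units_inv_closed unfolding carrier_eq by blast
  then have "\<phi> (u * v) = \<phi> 1"
    using u by (metis Units_r_inv hom_mult hom_one)
  then show "\<exists>v. \<phi> (u * v) = \<phi> 1" ..
next
  assume "\<exists>v. \<phi> (u * v) = \<phi> 1"
  then obtain v where v: "\<phi> u \<otimes> \<phi> v = \<one>"
    by (auto simp: hom_mult hom_one)
  then have "\<phi> v \<otimes> \<phi> u = \<one>"
    by (simp add: m_comm)
  with v show "\<phi> u \<in> Units A"
    by (auto simp: Units_def)
qed

end

lemma (in residues) of_nat_one_eq: "[n] \<cdot> \<one> = int n mod m"
  by (induction n) (simp_all add: res_zero_eq res_one_eq res_add_eq mod_add_left_eq mod_add_right_eq ac_simps)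

lemma less_5_iff: "i < 5 \<longleftrightarrow> i = 0 \<or> i = 1 \<or> i = 2 \<or> i = 3 \<or> i = (4::nat)"
  by presburger

lemma all_less_5: "(\<forall>i<5. P i) \<longleftrightarrow> P 0 \<and> P 1 \<and> P 2 \<and> P 3 \<and> P (4::nat)"
  using less_5_iff by metis

lemma sum_less_5: "(\<Sum>j<5. f j) = f 0 + f 1 + f 2 + f 3 + f (4::nat)"
  by (simp add: lessThan_nat_numeral ac_simps)

text \<open>The index \<open>(i + (5 - j)) mod 5\<close> is \<open>i - j\<close> modulo 5, written
  without truncated subtraction. The sum has the shape of the convolution in
  \<open>group_ring\<close>.\<close>

lemma zcoeff_mult:
  assumes "i < 5"
  shows "zcoeff (u * v) i = (\<Sum>j<5. zcoeff u j * zcoeff v ((i + (5 - j)) mod 5))"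
proof (cases u; cases v)
  fix a b c d e a' b' c' d' e'
  assume [simp]: "u = ZC a b c d e" "v = ZC a' b' c' d' e'"
  show ?thesis
    using assms unfolding less_5_iff sum_less_5 by (elim disjE; hypsubst; simp)
qed

lemma zcoeff_add: "i < 5 \<Longrightarrow> zcoeff (u + v) i = zcoeff u i + zcoeff v i"
  unfolding less_5_iff by (cases u; cases v) auto

locale group_ring_order5 = group C for C :: "('g, 'n) monoid_scheme" (structure) +
  fixes g :: 'g and m :: int
  assumes order: "order C = 5" and g: "g \<in> carrier C" and gen: "carrier C = generate C {g}"
    and m: "1 < m"
begin

abbreviation R where "R \<equiv> residue_ring m"

abbreviation A where "A \<equiv> group_ring R C"

text \<open>Reduction of coefficients modulo \<open>m\<close>; the description operator reads off
  the exponent of \<open>y\<close> with respect to \<open>g\<close>.\<close>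

definition zhom :: "zc5 \<Rightarrow> 'g \<Rightarrow> int" where
  "zhom u = (\<lambda>y\<in>carrier C. zcoeff u (THE i. i < 5 \<and> y = g [^] i) mod m)"

sublocale R: residues m R
  by unfold_locales (use m in auto)

lemma ord_g: "ord g = 5"
  using generate_pow_card[OF g] gen order unfolding order_def by metis

lemma pow_g_eq_iff: "g [^] (i::nat) = g [^] (j::nat) \<longleftrightarrow> i mod 5 = j mod 5"
proof -
  have "g [^] i = g [^] j \<longleftrightarrow> int (ord g) dvd int j - int i"
    using int_pow_eq[OF g, of "int i" "int j"] unfolding int_pow_int .
  also have "\<dots> \<longleftrightarrow> int j mod int 5 = int i mod int 5"
    unfolding ord_g by (rule mod_eq_dvd_iff [symmetric])
  also have "\<dots> \<longleftrightarrow> i mod 5 = j mod 5"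
    unfolding of_nat_mod [symmetric] of_nat_eq_iff by (rule eq_commute)
  finally show ?thesis .
qed

lemma g_neq_one: "g \<noteq> \<one>"
  using pow_g_eq_iff[of 1 0] g by simp

lemma carrier_C: "carrier C = (\<lambda>i. g [^] i) ` {..<5::nat}"
proof -
  have "finite (carrier C)"
    using order by (metis card.infinite order_def zero_neq_numeral)
  then have C: "carrier C = {g [^] k | k. k \<in> (UNIV :: nat set)}"
    using trans[OF gen generate_pow_on_finite_carrier[OF _ g]] by blast
  have "g [^] k = g [^] (k mod 5)" for k :: nat
    by (simp add: pow_g_eq_iff)
  moreover have "k mod 5 \<in> {..<5}" for k :: nat
    by simp
  ultimately show ?thesis
    unfolding C by blast
qed

lemma inj_on_pow_g: "inj_on (\<lambda>i. g [^] i) {..<5::nat}"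
  by (auto simp: inj_on_def pow_g_eq_iff)

lemma zhom_apply: "zhom u (g [^] i) = zcoeff u (i mod 5) mod m"
proof -
  have "(THE j. j < 5 \<and> g [^] i = g [^] j) = i mod 5"
    by (rule the_equality) (auto simp: pow_g_eq_iff)
  then show ?thesis
    using g by (simp add: zhom_def)
qed

lemma zhom_extensional: "zhom u \<in> extensional (carrier C)"
  by (simp add: zhom_def)

lemma zhom_eqI:
  assumes "f \<in> extensional (carrier C)" and "\<forall>i<5. f (g [^] i) = zcoeff u i mod m"
  shows "zhom u = f"
proof (rule extensionalityI)
  show "zhom u \<in> extensional (carrier C)"
    by (rule zhom_extensional)
  show "f \<in> extensional (carrier C)"
    by fact
  fix y assume "y \<in> carrier C"
  then obtain i :: nat where "i < 5" "y = g [^] i"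
    unfolding carrier_C by auto
  then show "zhom u y = f y"
    using assms(2) by (simp add: zhom_apply)
qed

lemmas zhom_eqI5 = zhom_eqI [unfolded all_less_5, OF _ conjI [OF _ conjI [OF _ conjI [OF _ conjI]]]]

text \<open>The kernel of \<open>zhom\<close> is the ideal generated by \<open>m\<close>, because
  both sides compare coefficients modulo \<open>m\<close>.\<close>

lemma zhom_eq_iff: "zhom u = zhom v \<longleftrightarrow> of_int m dvd u - v"
proof -
  have "zhom u = zhom v \<longleftrightarrow> (\<forall>i<5. zcoeff u i mod m = zcoeff v i mod m)"
  proof
    assume eq: "zhom u = zhom v"
    show "\<forall>i<5. zcoeff u i mod m = zcoeff v i mod m"
    proof (intro allI impI)
      fix i :: nat assume "i < 5"
      then show "zcoeff u i mod m = zcoeff v i mod m"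
        using zhom_apply[of u i] zhom_apply[of v i] eq by simp
    qed
  next
    assume "\<forall>i<5. zcoeff u i mod m = zcoeff v i mod m"
    then show "zhom u = zhom v"
      by (intro zhom_eqI) (simp_all add: zhom_extensional zhom_apply)
  qed
  also have "\<dots> \<longleftrightarrow> of_int m dvd u - v"
    unfolding all_less_5 by (cases u; cases v) (simp add: of_int_dvd_zc5_iff mod_eq_dvd_iff)
  finally show ?thesis .
qed

lemma carrier_group_ring: "carrier A = range zhom"
proof
  show "carrier A \<subseteq> range zhom"
  proof
    fix f assume "f \<in> carrier A"
    then have f: "f \<in> carrier C \<rightarrow>\<^sub>E {0..m - 1}"
      by (simp add: group_ring_def R.res_carrier_eq)
    have "f y mod m = f y" if "y \<in> carrier C" for y
      using f that by (auto simp: PiE_def Pi_def)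
    moreover have "g [^] i \<in> carrier C" for i :: nat
      using g by simp
    \<comment> \<open>The coefficients of \<open>f\<close> are already reduced, so they serve as
      their own integral lifts.\<close>
    ultimately have "zhom (ZC (f (g [^] (0::nat))) (f (g [^] (1::nat))) (f (g [^] (2::nat)))
        (f (g [^] (3::nat))) (f (g [^] (4::nat)))) = f"
      using f g by (intro zhom_eqI5) (auto simp: PiE_def simp del: nat_pow_Suc)
    then show "f \<in> range zhom"
      by (metis rangeI)
  qed
  have "finite (carrier C)"
    unfolding carrier_C by simp
  then show "range zhom \<subseteq> carrier A"
    using m by (auto simp: group_ring_def R.res_carrier_eq zhom_def)
qed

lemma mult_group_ring_apply:
  assumes i: "i < 5"
  shows "(zhom u \<otimes>\<^bsub>A\<^esub> zhom v) (g [^] i) = zcoeff (u * v) i mod m"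
proof -
  define S where "S = {y \<in> carrier C. zhom u y \<noteq> 0}"
  define F where "F = (\<lambda>y. zhom u y * zhom v (inv y \<otimes> g [^] i))"
  have fin: "finite (carrier C)"
    unfolding carrier_C by simp
  have "(zhom u \<otimes>\<^bsub>A\<^esub> zhom v) (g [^] i) = (\<Oplus>\<^bsub>R\<^esub>y\<in>S. F y mod m)"
    using g by (simp add: group_ring_def S_def F_def R.res_mult_eq R.res_zero_eq)
  also have "\<dots> = (\<Sum>y\<in>S. F y) mod m"
    using fin by (intro R.sum_cong) (simp add: S_def)
  \<comment> \<open>Outside the support the summand is zero, so the sum may run over the whole group
    and be reindexed by exponents.\<close>
  also have "(\<Sum>y\<in>S. F y) = (\<Sum>y\<in>carrier C. F y)"
    using fin by (intro sum.mono_neutral_left) (auto simp: S_def F_def)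
  also have "\<dots> = (\<Sum>j<5. F (g [^] (j::nat)))"
    unfolding carrier_C using inj_on_pow_g by (simp add: sum.reindex)
  also have "\<dots> = (\<Sum>j<5. (zcoeff u j mod m) * (zcoeff v ((i + (5 - j)) mod 5) mod m))"
  proof (rule sum.cong)
    fix j :: nat assume j: "j \<in> {..<5}"
    have "g [^] j \<otimes> g [^] (i + (5 - j)) = g [^] i"
      using j g by (simp add: nat_pow_mult pow_g_eq_iff)
    then have "inv (g [^] j) \<otimes> g [^] i = g [^] (i + (5 - j))"
      using g inv_solve_left' by simp
    then show "F (g [^] j) = (zcoeff u j mod m) * (zcoeff v ((i + (5 - j)) mod 5) mod m)"
      using j by (simp add: F_def zhom_apply)
  qed simp
  also have "\<dots> mod m = (\<Sum>j<5. zcoeff u j * zcoeff v ((i + (5 - j)) mod 5)) mod m"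
    by (rule trans [OF mod_sum_eq [symmetric]], rule trans [OF _ mod_sum_eq]) (simp add: mod_mult_eq)
  finally show ?thesis
    using zcoeff_mult[OF i] by simp
qed

sublocale A: comm_ring_image A zhom
proof
  show "carrier A = range zhom"
    by (rule carrier_group_ring)
  show "zhom 0 = \<zero>\<^bsub>A\<^esub>"
    using g by (intro zhom_eqI5)
      (simp_all add: group_ring_def R.res_zero_eq zero_zc5_def del: nat_pow_Suc)
  have "g [^] i = \<one> \<longleftrightarrow> i = 0" if "i < 5" for i :: nat
    using that pow_g_eq_iff[of i 0] by simp
  then show "zhom 1 = \<one>\<^bsub>A\<^esub>"
    using g m g_neq_one by (intro zhom_eqI5)
      (simp_all add: group_ring_def R.res_zero_eq R.res_one_eq one_zc5_def del: nat_pow_Suc)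
  show "zhom (u + v) = zhom u \<oplus>\<^bsub>A\<^esub> zhom v" for u v
    using g by (intro zhom_eqI)
      (simp_all add: group_ring_def R.res_add_eq zhom_apply zcoeff_add mod_simps)
  show "zhom (u * v) = zhom u \<otimes>\<^bsub>A\<^esub> zhom v" for u v
    by (intro zhom_eqI allI impI mult_group_ring_apply) (simp_all add: group_ring_def)
qed

lemma gr_monom_g: "gr_monom R C \<one>\<^bsub>R\<^esub> g = zhom zgen"
proof -
  have "g [^] i = g \<longleftrightarrow> i = 1" if "i < 5" for i :: nat
    using that pow_g_eq_iff[of i 1] g by simp
  then show ?thesis
    using g m g_neq_one by (intro zhom_eqI5 [symmetric])
      (simp_all add: gr_monom_def R.res_zero_eq R.res_one_eq del: nat_pow_Suc)
qed

lemma gr_monom_one: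
  assumes "c \<in> carrier R"
  shows "gr_monom R C c \<one> = zhom (of_int c)"
proof -
  have "g [^] i = \<one> \<longleftrightarrow> i = 0" if "i < 5" for i :: nat
    using that pow_g_eq_iff[of i 0] by simp
  then show ?thesis
    using g assms g_neq_one by (intro zhom_eqI5 [symmetric])
      (simp_all add: gr_monom_def R.res_zero_eq R.res_carrier_eq of_int_zc5 del: nat_pow_Suc)
qed

end

section \<open>The unit group modulo a power of two\<close>

locale group_ring_order5_two_power = group_ring_order5 C g m
  for C :: "('g, 'n) monoid_scheme" (structure) and g m +
  fixes r :: nat
  assumes m_eq: "m = 2 ^ r"
begin

abbreviation U where "U \<equiv> units_of A"

sublocale U: comm_group U
  by (rule A.units_comm_group)

lemma r_ge_1: "1 \<le> r"
  using m m_eq by (cases r) auto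

lemma zhom_eq_iff_two_power: "zhom u = zhom v \<longleftrightarrow> 2 ^ r dvd u - v"
  unfolding zhom_eq_iff by (simp add: m_eq)

lemma zhom_in_Units_iff: "zhom u \<in> Units A \<longleftrightarrow> (\<exists>v. 2 ^ r dvd u * v - 1)"
  by (simp add: A.Units_iff zhom_eq_iff_two_power)

lemma unit_mod_two:
  assumes "zhom u \<in> Units A"
  shows "\<exists>v. 2 dvd u * v - 1"
proof -
  obtain v where "2 ^ r dvd u * v - 1"
    using assms zhom_in_Units_iff by blast
  moreover have "(2::zc5) dvd 2 ^ r"
    using r_ge_1 by simp
  ultimately show ?thesis
    using dvd_trans by blast
qed

text \<open>The power with exponent \<open>n - 1\<close> is an inverse.\<close>

lemma zhom_in_UnitsI:
  assumes "2 ^ r dvd u ^ n - 1" "0 < n"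
  shows "zhom u \<in> Units A"
  using assms by (cases n) (auto simp: zhom_in_Units_iff)

lemma zhom_pow_eq_one:
  assumes "2 ^ r dvd u ^ n - 1" "0 < n"
  shows "zhom u [^]\<^bsub>U\<^esub> n = \<one>\<^bsub>U\<^esub>"
  using A.units_of_pow[OF zhom_in_UnitsI[OF assms], of n] assms(1)
  by (simp add: units_of_one zhom_eq_iff_two_power flip: A.hom_power A.hom_one)

text \<open>This makes the layer argument applicable to subgroups generated by given units.\<close>

lemma subgroup_mod_two_power:
  assumes S: "subgroup S U"
  shows "subgroup_mod_two_power {u. zhom u \<in> S} r"
proof
  interpret S: subgroup S U by fact
  show "1 \<in> {u. zhom u \<in> S}"
    using S.one_closed by (simp add: units_of_one A.hom_one)
  show "u * v \<in> {u. zhom u \<in> S}" if "u \<in> {u. zhom u \<in> S}" "v \<in> {u. zhom u \<in> S}" for u v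
    using that S.m_closed by (simp add: units_of_mult A.hom_mult)
  show "\<exists>v\<in>{u. zhom u \<in> S}. 2 ^ r dvd u * v - 1" if "u \<in> {u. zhom u \<in> S}" for u
  proof -
    have u: "zhom u \<in> S"
      using that by simp
    then have "inv\<^bsub>U\<^esub> zhom u \<in> S"
      by (rule S.m_inv_closed)
    moreover have "inv\<^bsub>U\<^esub> zhom u \<in> carrier A"
      using calculation S.subset A.Units_closed by (auto simp: units_of_carrier)
    then obtain v where v: "inv\<^bsub>U\<^esub> zhom u = zhom v"
      unfolding A.carrier_eq by blast
    moreover have "zhom (u * v) = zhom 1"
      using U.r_inv[of "zhom u"] S.mem_carrier[OF u]
      by (simp add: v units_of_mult units_of_one A.hom_mult A.hom_one)
    ultimately show ?thesis
      unfolding zhom_eq_iff_two_power by auto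
  qed
  show "v \<in> {u. zhom u \<in> S}" if "u \<in> {u. zhom u \<in> S}" "2 ^ r dvd v - u" for u v
    using that by (metis mem_Collect_eq zhom_eq_iff_two_power)
qed

lemma ztri_power_15_mod_two: "2 dvd ztri ^ 15 - 1"
  by (simp add: ztri_power_15 one_zc5_def zc5_dvd_iff)

text \<open>The elements \<open>ztri ^ j + 2 * w\<close>, with \<open>j\<close> below 15 and the
  coefficients of \<open>w\<close> taken modulo \<open>2 ^ (r - 1)\<close>, are pairwise distinct
  units. Only the lower bound is needed for the counting argument.\<close>

lemma order_U_ge: "15 * (2 ^ (r - 1)) ^ 5 \<le> order U"
proof -
  define N where "N = {0..<2 ^ (r - 1) :: int}"
  define F where "F = (\<lambda>(j, a, b, c, d, e). zhom (ztri ^ j + 2 * ZC a b c d e))"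
  define D where "D = {..<15::nat} \<times> N \<times> N \<times> N \<times> N \<times> N"
  have "inj_on F D"
  proof (rule inj_onI)
    fix p q assume p: "p \<in> D" and q: "q \<in> D" and eq: "F p = F q"
    obtain j a b c d e where p': "p = (j, a, b, c, d, e)"
      by (cases p)
    obtain j' a' b' c' d' e' where q': "q = (j', a', b', c', d', e')"
      by (cases q)
    define w where "w = ZC a b c d e - ZC a' b' c' d' e'"
    have "2 ^ r dvd (ztri ^ j + 2 * ZC a b c d e) - (ztri ^ j' + 2 * ZC a' b' c' d' e')"
      using eq unfolding F_def p' q' prod.case zhom_eq_iff_two_power .
    then have dvd: "2 ^ r dvd ztri ^ j - ztri ^ j' + 2 * w"
      unfolding w_def by (simp only: algebra_simps)
    moreover have "(2::zc5) dvd 2 ^ r"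
      using r_ge_1 by simp
    ultimately have "2 dvd ztri ^ j - ztri ^ j' + 2 * w"
      using dvd_trans by blast
    then have "2 dvd ztri ^ j - ztri ^ j'"
      by (simp only: dvd_add_left_iff dvd_triv_left)
    then have j: "j = j'"
      using p q by (intro distinct_ztri_powers_mod_two) (auto simp: D_def p' q')
    have "2 ^ Suc (r - 1) dvd 2 * w"
      using dvd r_ge_1 by (simp add: j)
    moreover have "2 * w = ZC (2 * (a - a')) (2 * (b - b')) (2 * (c - c')) (2 * (d - d')) (2 * (e - e'))"
      by (simp add: w_def numeral_zc5)
    ultimately have "2 ^ Suc (r - 1) dvd ZC (2 * (a - a')) (2 * (b - b')) (2 * (c - c')) (2 * (d - d')) (2 * (e - e'))"
      by (simp only:)
    then have "2 ^ (r - 1) dvd a - a' \<and> 2 ^ (r - 1) dvd b - b' \<and> 2 ^ (r - 1) dvd c - c' \<and>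
        2 ^ (r - 1) dvd d - d' \<and> 2 ^ (r - 1) dvd e - e'"
      unfolding numeral_power_dvd_zc5_iff unfolding power_Suc dvd_mult_cancel_left by simp
    moreover have "x = y" if "x \<in> N" "y \<in> N" "2 ^ (r - 1) dvd x - y" for x y
      using that by (metis N_def atLeastLessThan_iff mod_eq_dvd_iff mod_pos_pos_trivial)
    ultimately show "p = q"
      using p q by (auto simp: D_def p' q' j)
  qed
  have "F ` D \<subseteq> carrier U"
  proof clarify
    fix j a b c d e
    let ?u = "ztri ^ j + 2 * ZC a b c d e"
    \<comment> \<open>Modulo 2 the fifteenth power of \<open>?u\<close> is 1, so a further power of
      two as exponent gives 1 modulo \<open>2 ^ r\<close>.\<close>
    have "2 dvd (ztri ^ 15) ^ j - 1 ^ j"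
      using ztri_power_15_mod_two by (rule dvd_diff_power)
    moreover have "2 dvd ?u ^ 15 - (ztri ^ j) ^ 15"
      by (rule dvd_diff_power) simp
    ultimately have "2 dvd ?u ^ 15 - 1"
      using dvd_diff_trans by (simp add: mult.commute flip: power_mult) blast
    then have "2 ^ Suc (r - 1) dvd (?u ^ 15) ^ (2 ^ (r - 1)) - 1"
      by (rule power_two_dvd')
    then have "2 ^ r dvd ?u ^ (15 * 2 ^ (r - 1)) - 1"
      using r_ge_1 by (simp add: power_mult)
    then show "F (j, a, b, c, d, e) \<in> carrier U"
      unfolding F_def prod.case units_of_carrier by (rule zhom_in_UnitsI) simp
  qed
  \<comment> \<open>Finiteness lets the injection bound \<open>card (carrier U)\<close>, as
    \<open>card\<close> is 0 on infinite sets.\<close>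
  moreover have "finite (carrier U)"
  proof -
    have "carrier A \<subseteq> carrier C \<rightarrow>\<^sub>E {0..m - 1}"
      by (auto simp: group_ring_def R.res_carrier_eq)
    moreover have "finite (carrier C \<rightarrow>\<^sub>E {0..m - 1})"
      by (intro finite_PiE) (auto simp: carrier_C)
    ultimately show ?thesis
      using A.Units_closed by (auto simp: units_of_carrier intro: finite_subset)
  qed
  ultimately have "card D \<le> order U"
    unfolding order_def using \<open>inj_on F D\<close> card_inj_on_le by blast
  then show ?thesis
    by (simp add: D_def N_def card_cartesian_product nat_power_eq power_numeral_reduce)
qed


lemma generators:
  defines "x \<equiv> gr_monom R C \<one>\<^bsub>R\<^esub> g"
  shows "[(5::nat)] \<cdot>\<^bsub>A\<^esub> \<one>\<^bsub>A\<^esub> = zhom 5"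
    and "\<ominus>\<^bsub>A\<^esub> \<one>\<^bsub>A\<^esub> = zhom (- 1)"
    and "\<one>\<^bsub>A\<^esub> \<oplus>\<^bsub>A\<^esub> x \<oplus>\<^bsub>A\<^esub> x [^]\<^bsub>A\<^esub> (2::nat) = zhom ztri"
    and "\<one>\<^bsub>A\<^esub> \<oplus>\<^bsub>A\<^esub> [(2::nat)] \<cdot>\<^bsub>A\<^esub> x = zhom (1 + 2 * zgen)"
    and "\<one>\<^bsub>A\<^esub> \<oplus>\<^bsub>A\<^esub> [(2::nat)] \<cdot>\<^bsub>A\<^esub> (x [^]\<^bsub>A\<^esub> (2::nat)) = zhom (1 + 2 * zgen\<^sup>2)"
    and "\<one>\<^bsub>A\<^esub> \<oplus>\<^bsub>A\<^esub> [(4::nat)] \<cdot>\<^bsub>A\<^esub> x = zhom (1 + 4 * zgen)"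
    and "c \<in> carrier R \<Longrightarrow> (gr_monom R C c \<one> \<otimes>\<^bsub>A\<^esub>
      (\<one>\<^bsub>A\<^esub> \<oplus>\<^bsub>A\<^esub> x \<oplus>\<^bsub>A\<^esub> x [^]\<^bsub>A\<^esub> (2::nat) \<oplus>\<^bsub>A\<^esub> x [^]\<^bsub>A\<^esub> (3::nat) \<oplus>\<^bsub>A\<^esub> x [^]\<^bsub>A\<^esub> (4::nat)))
      \<ominus>\<^bsub>A\<^esub> \<one>\<^bsub>A\<^esub> = zhom (of_int c * zhat - 1)"
proof -
  \<comment> \<open>Read from right to left, the homomorphism laws fold an expression over
    \<open>A\<close> into a single application of \<open>zhom\<close>.\<close>
  note hom = A.hom_one [symmetric] A.hom_power [symmetric] A.hom_numeral_mult [symmetric]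
    A.hom_uminus [symmetric] A.hom_add [symmetric] A.hom_mult [symmetric] A.hom_diff [symmetric]
  have x: "x = zhom zgen"
    unfolding x_def by (rule gr_monom_g)
  show "[(5::nat)] \<cdot>\<^bsub>A\<^esub> \<one>\<^bsub>A\<^esub> = zhom 5"
    unfolding hom by simp
  show "\<ominus>\<^bsub>A\<^esub> \<one>\<^bsub>A\<^esub> = zhom (- 1)"
    unfolding hom ..
  have "1 + zgen + zgen\<^sup>2 = ztri"
    by (simp add: one_zc5_def power2_eq_square)
  then show "\<one>\<^bsub>A\<^esub> \<oplus>\<^bsub>A\<^esub> x \<oplus>\<^bsub>A\<^esub> x [^]\<^bsub>A\<^esub> (2::nat) = zhom ztri"
    unfolding x hom by simp
  show "\<one>\<^bsub>A\<^esub> \<oplus>\<^bsub>A\<^esub> [(2::nat)] \<cdot>\<^bsub>A\<^esub> x = zhom (1 + 2 * zgen)"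
    unfolding x hom ..
  show "\<one>\<^bsub>A\<^esub> \<oplus>\<^bsub>A\<^esub> [(2::nat)] \<cdot>\<^bsub>A\<^esub> (x [^]\<^bsub>A\<^esub> (2::nat)) = zhom (1 + 2 * zgen\<^sup>2)"
    unfolding x hom ..
  show "\<one>\<^bsub>A\<^esub> \<oplus>\<^bsub>A\<^esub> [(4::nat)] \<cdot>\<^bsub>A\<^esub> x = zhom (1 + 4 * zgen)"
    unfolding x hom ..
  assume c: "c \<in> carrier R"
  have "1 + zgen + zgen\<^sup>2 + zgen ^ 3 + zgen ^ 4 = zhat"
    by (simp add: one_zc5_def power_numeral_reduce)
  then show "(gr_monom R C c \<one> \<otimes>\<^bsub>A\<^esub>
      (\<one>\<^bsub>A\<^esub> \<oplus>\<^bsub>A\<^esub> x \<oplus>\<^bsub>A\<^esub> x [^]\<^bsub>A\<^esub> (2::nat) \<oplus>\<^bsub>A\<^esub> x [^]\<^bsub>A\<^esub> (3::nat) \<oplus>\<^bsub>A\<^esub> x [^]\<^bsub>A\<^esub> (4::nat)))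
      \<ominus>\<^bsub>A\<^esub> \<one>\<^bsub>A\<^esub> = zhom (of_int c * zhat - 1)"
    unfolding x gr_monom_one[OF c] hom by simp
qed

text \<open>As 5 is odd, it is invertible modulo \<open>2 ^ r\<close>; then \<open>5 * a = 3\<close>
  gives \<open>5 * (1 - a) = 5 - 3\<close>.\<close>

lemma coefficient_cong:
  defines "a \<equiv> ([(3::nat)] \<cdot>\<^bsub>R\<^esub> \<one>\<^bsub>R\<^esub>) \<otimes>\<^bsub>R\<^esub> inv\<^bsub>R\<^esub> ([(5::nat)] \<cdot>\<^bsub>R\<^esub> \<one>\<^bsub>R\<^esub>)"
  shows "\<one>\<^bsub>R\<^esub> \<ominus>\<^bsub>R\<^esub> a \<in> carrier R" and "[5 * (\<one>\<^bsub>R\<^esub> \<ominus>\<^bsub>R\<^esub> a) = 2] (mod m)"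
proof -
  have "coprime (5::int) m"
    by (simp add: m_eq)
  then have unit: "[(5::nat)] \<cdot>\<^bsub>R\<^esub> \<one>\<^bsub>R\<^esub> \<in> Units R"
    using m by (simp add: R.of_nat_one_eq)
  have a: "a \<in> carrier R"
    unfolding a_def using unit by (simp add: R.Units_inv_closed)
  show "\<one>\<^bsub>R\<^esub> \<ominus>\<^bsub>R\<^esub> a \<in> carrier R"
    using a by simp
  have "([(5::nat)] \<cdot>\<^bsub>R\<^esub> \<one>\<^bsub>R\<^esub>) \<otimes>\<^bsub>R\<^esub> a = [(3::nat)] \<cdot>\<^bsub>R\<^esub> \<one>\<^bsub>R\<^esub>"
    unfolding a_def using unit
    by (metis R.Units_closed R.Units_inv_closed R.Units_r_inv R.add.nat_pow_closed R.m_lcomm R.one_closed R.r_one)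
  then have "[5 * a = 3] (mod m)"
    by (simp add: R.of_nat_one_eq R.res_mult_eq cong_def mod_mult_left_eq)
  then have "[5 - 5 * a = 5 - 3] (mod m)"
    by (intro cong_diff cong_refl)
  moreover have "\<one>\<^bsub>R\<^esub> \<ominus>\<^bsub>R\<^esub> a = (1 - a) mod m"
    by (simp add: a_minus_def R.res_neg_eq R.res_add_eq R.res_one_eq mod_add_right_eq)
  ultimately show "[5 * (\<one>\<^bsub>R\<^esub> \<ominus>\<^bsub>R\<^esub> a) = 2] (mod m)"
    by (simp add: cong_def mod_mult_right_eq right_diff_distrib)
qed

lemma units_mod_two:
  assumes "r = 1"
  shows "carrier U = generate U {zhom ztri}"
    and "U\<lparr>carrier := generate U {zhom ztri}\<rparr> \<cong> integer_mod_group 15"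
proof -
  have pow: "2 ^ r dvd ztri ^ 15 - 1"
    unfolding assms power_one_right by (rule ztri_power_15_mod_two)
  have mem: "zhom ztri \<in> carrier U"
    unfolding units_of_carrier by (rule zhom_in_UnitsI[OF pow]) simp
  have sub: "subgroup (generate U {zhom ztri}) U"
    using mem by (intro U.generate_is_subgroup) simp
  interpret P: subgroup_mod_two_power "{u. zhom u \<in> generate U {zhom ztri}}" r
    using sub by (rule subgroup_mod_two_power)
  have gen: "carrier U \<subseteq> generate U {zhom ztri}"
  proof
    fix y assume y: "y \<in> carrier U"
    then obtain u where u: "y = zhom u"
      using A.Units_closed unfolding units_of_carrier A.carrier_eq by blast
    obtain v where "2 dvd u * v - 1"
      using unit_mod_two y by (auto simp: units_of_carrier u)
    then obtain j where "2 ^ r dvd u - ztri ^ j"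
      using unit_mod_two_zc5 assms by force
    moreover have "ztri ^ j \<in> {u. zhom u \<in> generate U {zhom ztri}}"
      by (intro P.power) (simp add: generate.incl)
    ultimately show "y \<in> generate U {zhom ztri}"
      using P.cong u by blast
  qed
  then show "carrier U = generate U {zhom ztri}"
    using subgroup.subset[OF sub] by blast
  \<comment> \<open>The decomposition is used with a single factor; for \<open>r = 1\<close> the
    lower bound on the order is 15.\<close>
  show "U\<lparr>carrier := generate U {zhom ztri}\<rparr> \<cong> integer_mod_group 15"
    using gen order_U_ge assms mem zhom_pow_eq_one[OF pow]
    by (intro U.cyclic_decomposition(2)[of "{()}" "\<lambda>_. zhom ztri" "\<lambda>_. 15"]) simp_all
qed

lemma units_decomposition:
  assumes r: "2 \<le> r" and c: "[5 * c = 2] (mod m)"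
  defines "n \<equiv> [2 ^ (r - 2), 2, 15 * 2 ^ (r - 1), 2 ^ (r - 1), 2 ^ (r - 1), 2 ^ (r - 2), 2]"
    and "L \<equiv> zc5_generators c"
  shows "internal_direct_product U {..<7} (\<lambda>i. generate U {zhom (L ! i)})"
    and "i < 7 \<Longrightarrow> U\<lparr>carrier := generate U {zhom (L ! i)}\<rparr> \<cong> integer_mod_group (n ! i)"
proof -
  let ?a = "\<lambda>i. zhom (L ! i)"
  have len: "length L = 7"
    unfolding L_def by (rule length_zc5_generators)
  have pow: "2 ^ r dvd (L ! i) ^ (n ! i) - 1" if "i < 7" for i
    unfolding L_def n_def using zc5_generators_power[OF r _ that] c m_eq by simp
  have n: "0 < n ! i" if "i < 7" for i
  proof -
    have "\<forall>k\<in>set n. 0 < k" "length n = 7"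
      by (simp_all add: n_def)
    then show ?thesis
      using that nth_mem by metis
  qed
  have mem: "?a i \<in> carrier U" if "i < 7" for i
    unfolding units_of_carrier using zhom_in_UnitsI[OF pow n] that by blast
  have sub: "subgroup (generate U (?a ` {..<7})) U"
    using mem by (intro U.generate_is_subgroup) auto
  interpret P: subgroup_mod_two_power_zc5 "{u. zhom u \<in> generate U (?a ` {..<7})}" r
    unfolding subgroup_mod_two_power_zc5_def using sub by (rule subgroup_mod_two_power)
  have gens: "set L \<subseteq> {u. zhom u \<in> generate U (?a ` {..<7})}"
    using len by (force simp: in_set_conv_nth intro: generate.incl)
  have gen: "carrier U \<subseteq> generate U (?a ` {..<7})"
  proof
    fix y assume y: "y \<in> carrier U"
    then obtain u where u: "y = zhom u"
      using A.Units_closed unfolding units_of_carrier A.carrier_eq by blast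
    obtain v where "2 dvd u * v - 1"
      using unit_mod_two y by (auto simp: units_of_carrier u)
    then show "y \<in> generate U (?a ` {..<7})"
      using P.unit_mem[OF r] gens c m_eq u unfolding L_def by blast
  qed
  obtain k where k: "r = 2 + k"
    using r le_Suc_ex by blast
  \<comment> \<open>The exponents of 2 add up to \<open>2 * (r - 2) + 3 * (r - 1) + 2\<close>, which
    is \<open>5 * (r - 1)\<close>.\<close>
  have "(\<Prod>i<7. n ! i) = 15 * (2 ^ (r - 1)) ^ 5"
    by (simp add: n_def k lessThan_nat_numeral power_numeral_reduce)
  then have card: "(\<Prod>i<7. n ! i) \<le> order U"
    using order_U_ge by simp
  have one: "?a i [^]\<^bsub>U\<^esub> (n ! i) = \<one>\<^bsub>U\<^esub>" if "i < 7" for i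
    using zhom_pow_eq_one[OF pow n] that by blast
  show "internal_direct_product U {..<7} (\<lambda>i. generate U {?a i})"
    by (rule U.cyclic_decomposition(1)[where n = "\<lambda>i. n ! i"])
      (use mem n one gen card in auto)
  show "U\<lparr>carrier := generate U {?a i}\<rparr> \<cong> integer_mod_group (n ! i)" if "i < 7"
    by (rule U.cyclic_decomposition(2)[where I = "{..<7}" and a = ?a and n = "\<lambda>i. n ! i"])
      (use that mem n one gen card in auto)
qed

end

theorem proposition4p2:
  fixes C5 :: "('a, 'b) monoid_scheme" and g :: 'a
  assumes "group C5" and "order C5 = 5"
    and "g \<in> carrier C5" and "carrier C5 = generate C5 {g}"
  shows
    "(let R = residue_ring 2;
          A = group_ring R C5;
          U = units_of A;
          x = gr_monom R C5 \<one>\<^bsub>R\<^esub> g;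
          H = generate U {\<one>\<^bsub>A\<^esub> \<oplus>\<^bsub>A\<^esub> x \<oplus>\<^bsub>A\<^esub> x [^]\<^bsub>A\<^esub> (2::nat)}
      in carrier U = H \<and> U\<lparr>carrier := H\<rparr> \<cong> integer_mod_group 15)
     \<and>
     (\<forall>r::nat. r > 1 \<longrightarrow>
       (let R = residue_ring (2 ^ r);
            A = group_ring R C5;
            U = units_of A;
            x = gr_monom R C5 \<one>\<^bsub>R\<^esub> g;
            a = ([(3::nat)] \<cdot>\<^bsub>R\<^esub> \<one>\<^bsub>R\<^esub>) \<otimes>\<^bsub>R\<^esub> inv\<^bsub>R\<^esub> ([(5::nat)] \<cdot>\<^bsub>R\<^esub> \<one>\<^bsub>R\<^esub>);
            ghat = \<one>\<^bsub>A\<^esub> \<oplus>\<^bsub>A\<^esub> x \<oplus>\<^bsub>A\<^esub> x [^]\<^bsub>A\<^esub> (2::nat) \<oplus>\<^bsub>A\<^esub> x [^]\<^bsub>A\<^esub> (3::nat) \<oplus>\<^bsub>A\<^esub> x [^]\<^bsub>A\<^esub> (4::nat);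
            G1 = generate U {[(5::nat)] \<cdot>\<^bsub>A\<^esub> \<one>\<^bsub>A\<^esub>};
            G2 = generate U {\<ominus>\<^bsub>A\<^esub> \<one>\<^bsub>A\<^esub>};
            G3 = generate U {\<one>\<^bsub>A\<^esub> \<oplus>\<^bsub>A\<^esub> x \<oplus>\<^bsub>A\<^esub> x [^]\<^bsub>A\<^esub> (2::nat)};
            G4 = generate U {\<one>\<^bsub>A\<^esub> \<oplus>\<^bsub>A\<^esub> [(2::nat)] \<cdot>\<^bsub>A\<^esub> x};
            G5 = generate U {\<one>\<^bsub>A\<^esub> \<oplus>\<^bsub>A\<^esub> [(2::nat)] \<cdot>\<^bsub>A\<^esub> (x [^]\<^bsub>A\<^esub> (2::nat))};
            G6 = generate U {\<one>\<^bsub>A\<^esub> \<oplus>\<^bsub>A\<^esub> [(4::nat)] \<cdot>\<^bsub>A\<^esub> x};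
            G7 = generate U {(gr_monom R C5 (\<one>\<^bsub>R\<^esub> \<ominus>\<^bsub>R\<^esub> a) \<one>\<^bsub>C5\<^esub> \<otimes>\<^bsub>A\<^esub> ghat) \<ominus>\<^bsub>A\<^esub> \<one>\<^bsub>A\<^esub>}
        in internal_direct_product U {..<7} ((!) [G1, G2, G3, G4, G5, G6, G7])
           \<and> U\<lparr>carrier := G1\<rparr> \<cong> integer_mod_group (2 ^ (r - 2))
           \<and> U\<lparr>carrier := G2\<rparr> \<cong> integer_mod_group 2
           \<and> U\<lparr>carrier := G3\<rparr> \<cong> integer_mod_group (15 * 2 ^ (r - 1))
           \<and> U\<lparr>carrier := G4\<rparr> \<cong> integer_mod_group (2 ^ (r - 1))
           \<and> U\<lparr>carrier := G5\<rparr> \<cong> integer_mod_group (2 ^ (r - 1))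
           \<and> U\<lparr>carrier := G6\<rparr> \<cong> integer_mod_group (2 ^ (r - 2))
           \<and> U\<lparr>carrier := G7\<rparr> \<cong> integer_mod_group 2))"
proof (intro conjI allI impI, goal_cases)
  case 1
  interpret S: group_ring_order5_two_power C5 g 2 1
    by (intro group_ring_order5_two_power.intro group_ring_order5.intro
        group_ring_order5_axioms.intro group_ring_order5_two_power_axioms.intro assms) simp_all
  show ?case
    unfolding Let_def S.generators using S.units_mod_two by blast
next
  case (2 r)
  interpret S: group_ring_order5_two_power C5 g "2 ^ r" r
    by (intro group_ring_order5_two_power.intro group_ring_order5.intro
        group_ring_order5_axioms.intro group_ring_order5_two_power_axioms.intro assms)
      (use 2 in simp_all)
  let ?R = "residue_ring (2 ^ r)"
  let ?c = "\<one>\<^bsub>?R\<^esub> \<ominus>\<^bsub>?R\<^esub>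
    (([(3::nat)] \<cdot>\<^bsub>?R\<^esub> \<one>\<^bsub>?R\<^esub>) \<otimes>\<^bsub>?R\<^esub> inv\<^bsub>?R\<^esub> ([(5::nat)] \<cdot>\<^bsub>?R\<^esub> \<one>\<^bsub>?R\<^esub>))"
  let ?L = "zc5_generators ?c" and ?H = "\<lambda>v. generate S.U {S.zhom v}"
  have "2 \<le> r"
    using 2 by simp
  note dec = S.units_decomposition[OF this S.coefficient_cong(2)]
  \<comment> \<open>The list of subgroups in the goal is the image of the list of
    generators.\<close>
  have "internal_direct_product S.U {..<7} ((!) (map ?H ?L))"
    using dec(1) by (subst internal_direct_product_cong[where K = "\<lambda>i. ?H (?L ! i)"])
      (simp_all add: length_zc5_generators)
  with dec(2)[of 0] dec(2)[of 1] dec(2)[of 2] dec(2)[of 3] dec(2)[of 4] dec(2)[of 5] dec(2)[of 6]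
  show ?case
    \<comment> \<open>The last generator is folded first, since the sum for \<open>ztri\<close> is a
      subterm of the sum for \<open>zhat\<close> and would otherwise be rewritten inside it.\<close>
    unfolding Let_def S.generators(7)[OF S.coefficient_cong(1)] unfolding S.generators(1-6)
    by (simp add: zc5_generators_def)
qed

end
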